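(* Let $\Gamma\subset\mathbb{R}^n$ be a lattice and let $V=V(\Gamma)$ be its set of visible points. Then $V$ is uniformly discrete, but has arbitrarily large holes. Moreover, for any $r>0$, there is a set of holes in $V$ of inradius at least $r$ whose centres have positive density.
   Context: A lattice in $\mathbb{R}^n$ is $\Gamma=\mathbb{Z}\mathbf{b}_1\oplus\cdots\oplus\mathbb{Z}\mathbf{b}_n$ with $\mathbf{b}_1,\dots,\mathbf{b}_n$ linearly independent. For $\mathbf{x}\in\Gamma\setminus\{\mathbf{0}\}$, $\mathrm{cont}(\mathbf{x})=\max\{l\in\mathbb{Z}^+\mid\mathbf{x}\in l\Gamma\}$; the visible points are $V(\Gamma)=\{\mathbf{x}\in\Gamma\setminus\{\mathbf{0}\}\mid\mathrm{cont}(\mathbf{x})=1\}$. A set $S\subset\mathbb{R}^n$ is uniformly discrete if there is $c>0$ such that $|\mathbf{x}-\mathbf{y}|\ge c$ for all distinct $\mathbf{x},\mathbf{y}\in S$. A hole in $V$ of inradius at least $r$ with centre $\mathbf{c}\in\mathbb{R}^n$ means that the ball of radius $r$ centred at $\mathbf{c}$ contains no point of $V$; "arbitrarily large holes" means that such holes exist for every $r>0$. A uniformly discrete set $C\subset\mathbb{R}^n$ has (natural) density $\mathcal{D}$ if $|\{\mathbf{x}\in C\mid|\mathbf{x}|<R\}|/(v_nR^n)\to\mathcal{D}$ as $R\to\infty$, where $v_n$ is the volume of the unit ball of $\mathbb{R}^n$. The last assertion thus says: for every $r>0$ there is a uniformly discrete set $C$ of centres of holes of inradius at least $r$ whose natural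 density exists and is positive. *)

theory Defs
  imports "HOL-Analysis.Analysis"
begin

definition is_lattice :: "(real ^ 'n) set \<Rightarrow> bool" where
  "is_lattice \<Gamma> \<longleftrightarrow>
     (\<exists>b :: 'n \<Rightarrow> real ^ 'n. inj b \<and> independent (range b) \<and>
        \<Gamma> = {\<Sum>i\<in>UNIV. real_of_int (k i) *\<^sub>R b i | k :: 'n \<Rightarrow> int. True})"

(* For a lattice and a nonzero lattice point the set below is finite and contains 1, so
   the maximum is genuine; only this case is used. *)
definition cont :: "(real ^ 'n) set \<Rightarrow> real ^ 'n \<Rightarrow> nat" where
  "cont \<Gamma> x = Max {l. l > 0 \<and> x \<in> (\<lambda>y. real l *\<^sub>R y) ` \<Gamma>}"

definition visible_points :: "(real ^ 'n) set \<Rightarrow> (real ^ 'n) set" where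
  "visible_points \<Gamma> = {x \<in> \<Gamma> - {0}. cont \<Gamma> x = 1}"

(* The ball is taken closed. This is the stronger convention. *)
definition hole_centre :: "(real ^ 'n) set \<Rightarrow> real \<Rightarrow> real ^ 'n \<Rightarrow> bool" where
  "hole_centre V r c \<longleftrightarrow> cball c r \<inter> V = {}"

(* Meaningful for uniformly discrete C, for which the sets counted are finite. *)
definition has_natural_density :: "(real ^ 'n) set \<Rightarrow> real \<Rightarrow> bool" where
  "has_natural_density C D \<longleftrightarrow>
     ((\<lambda>R. real (card {x \<in> C. norm x < R}) /
            (measure lebesgue (ball (0 :: real ^ 'n) 1) * R ^ CARD('n))) \<longlongrightarrow> D) at_top"

end

theory Submission
  imports Defs "HOL-Number_Theory.Cong"
begin

text \<open>
  A linear change of coordinates \<open>g\<close> identifies the lattice with the integer vectors. Uniform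
  discreteness then only expresses that an injective linear map shrinks norms by at most a
  constant factor (\<open>uniform_discrete_affine_integer_points\<close>), and it passes from the lattice to
  its visible points.

  Holes come from the Chinese remainder theorem. Only finitely many lattice vectors \<open>f\<close> have norm
  at most \<open>r\<close>. Attach to each of them its own prime \<open>p f\<close>, and choose a lattice point \<open>c\<close> such
  that every coordinate of \<open>c + f\<close> is divisible by \<open>p f\<close>, for all these \<open>f\<close> at once. The lattice
  points within distance \<open>r\<close> of \<open>c\<close> are precisely the \<open>c + f\<close>; each is the multiple of a lattice
  point by a prime, so none is visible.

  The congruences on \<open>c\<close> remain true when \<open>c\<close> is moved by \<open>N\<close> times any lattice vector, where \<open>N\<close>
  is the product of the primes \<open>p f\<close> (\<open>integer_progression_avoiding_coprimality\<close>). The centres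
  obtained therefore contain a translate of the lattice \<open>N \<Gamma>\<close>. Such a translate has a natural
  density, the reciprocal of the volume of a fundamental parallelepiped
  (\<open>natural_density_affine_integer_points\<close>): the copies of the half-open parallelepiped at the
  points in the ball of radius \<open>R\<close> are disjoint, and their union lies between the balls
  of radius \<open>R - d\<close> and \<open>R + d\<close>, where \<open>d\<close> bounds the norms in the parallelepiped; as \<open>R\<close> grows, the
  volumes of these balls are asymptotically equal.
\<close>

section \<open>Lattices as linear images of the integer vectors\<close>

definition int_vec :: "int ^ 'n \<Rightarrow> real ^ 'n" where
  "int_vec z = (\<chi> i. real_of_int (z $ i))"

lemma int_vec_nth [simp]: "int_vec z $ i = real_of_int (z $ i)"
  by (simp add: int_vec_def)

lemma int_vec_diff: "int_vec (y - z) = int_vec y - int_vec z"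
  by (simp add: vec_eq_iff)

lemma int_vec_eq_iff [simp]: "int_vec y = int_vec z \<longleftrightarrow> y = z"
  by (simp add: vec_eq_iff)

lemma one_le_norm_int_vec:
  assumes "z \<noteq> 0"
  shows "1 \<le> norm (int_vec z)"
proof -
  obtain i where "z $ i \<noteq> 0"
    using assms by (auto simp: vec_eq_iff)
  then have "1 \<le> \<bar>int_vec z $ i\<bar>"
    by simp
  also have "\<dots> \<le> norm (int_vec z)"
    by (rule component_le_norm_cart)
  finally show ?thesis .
qed

lemma lattice_linear_image:
  fixes \<Gamma> :: "(real ^ 'n) set"
  assumes "is_lattice \<Gamma>"
  obtains g :: "real ^ 'n \<Rightarrow> real ^ 'n"
  where "linear g" "inj g" "\<Gamma> = range (\<lambda>z. g (int_vec z))"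
proof -
  obtain b :: "'n \<Rightarrow> real ^ 'n" where b: "inj b" "independent (range b)"
    and \<Gamma>: "\<Gamma> = {\<Sum>i\<in>UNIV. real_of_int (k i) *\<^sub>R b i | k. True}"
    using assms unfolding is_lattice_def by blast
  define g :: "real ^ 'n \<Rightarrow> real ^ 'n" where "g x = (\<Sum>i\<in>UNIV. x $ i *\<^sub>R b i)" for x
  have lin: "linear g"
    by (rule linearI) (simp_all add: g_def scaleR_add_left sum.distrib scaleR_sum_right)
  have "x = 0" if "g x = 0" for x
  proof -
    have "(\<Sum>v\<in>range b. x $ inv b v *\<^sub>R v) = 0"
      using that b(1) by (simp add: g_def sum.reindex)
    then have "\<forall>v\<in>range b. x $ inv b v = 0"
      using b(2) unfolding independent_explicit by (auto simp: dest: spec[of _ "\<lambda>v. x $ inv b v"])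
    then show ?thesis
      using b(1) by (simp add: vec_eq_iff)
  qed
  then have "inj g"
    using linear_injective_0[OF lin] by blast
  moreover have "\<Gamma> = range (\<lambda>z. g (int_vec z))"
  proof (intro equalityI subsetI)
    fix y assume "y \<in> \<Gamma>"
    then obtain k :: "'n \<Rightarrow> int" where "y = (\<Sum>i\<in>UNIV. real_of_int (k i) *\<^sub>R b i)"
      unfolding \<Gamma> by blast
    then have "y = g (int_vec (\<chi> i. k i))"
      by (simp add: g_def)
    then show "y \<in> range (\<lambda>z. g (int_vec z))"
      by blast
  next
    fix y assume "y \<in> range (\<lambda>z. g (int_vec z))"
    then obtain z where "y = (\<Sum>i\<in>UNIV. real_of_int (z $ i) *\<^sub>R b i)"
      by (auto simp: g_def)
    then show "y \<in> \<Gamma>"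
      unfolding \<Gamma> by blast
  qed
  ultimately show thesis
    using that lin by blast
qed

lemma uniform_discrete_affine_integer_points:
  fixes g :: "real ^ 'n \<Rightarrow> real ^ 'n"
  assumes "linear g" "inj g"
  shows "uniform_discrete (range (\<lambda>z. t + g (int_vec z)))"
proof -
  obtain B where B: "B > 0" "\<And>x. B * norm x \<le> norm (g x)"
    using linear_inj_bounded_below_pos[OF assms] by blast
  have sep: "B \<le> dist (t + g (int_vec y)) (t + g (int_vec z))" if "y \<noteq> z" for y z
  proof -
    have "B * 1 \<le> B * norm (int_vec (y - z))"
      using that B(1) one_le_norm_int_vec[of "y - z"] by (intro mult_left_mono) auto
    also have "\<dots> \<le> norm (g (int_vec (y - z)))"
      by (rule B(2))
    also have "\<dots> = dist (t + g (int_vec y)) (t + g (int_vec z))"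
      by (simp add: int_vec_diff linear_diff[OF assms(1)] dist_norm)
    finally show ?thesis by simp
  qed
  show ?thesis
  proof (rule uniformI2[OF B(1)])
    fix p q
    assume "p \<in> range (\<lambda>z. t + g (int_vec z))" "q \<in> range (\<lambda>z. t + g (int_vec z))"
    then obtain y z where "p = t + g (int_vec y)" "q = t + g (int_vec z)"
      by (elim rangeE)
    then show "B \<le> dist p q" if "p \<noteq> q"
      using that sep[of y z] by auto
  qed
qed

lemma finite_affine_integer_points_bounded:
  fixes g :: "real ^ 'n \<Rightarrow> real ^ 'n"
  assumes "linear g" "inj g"
  shows "finite {z. norm (t + g (int_vec z)) \<le> r}"
proof -
  let ?h = "\<lambda>z. t + g (int_vec z)"
  let ?S = "range ?h \<inter> cball 0 r"
  have "uniform_discrete ?S"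
    by (rule uniform_discrete_subset[OF uniform_discrete_affine_integer_points[OF assms, of t]]) blast
  then have "finite ?S"
    using uniform_discrete_finite_iff[of ?S] bounded_subset[OF bounded_cball, of ?S 0 r]
    by blast
  moreover have "inj ?h"
    by (intro injI) (simp add: inj_eq[OF assms(2)])
  ultimately have "finite (?h -` ?S)"
    by (rule finite_vimageI)
  then show ?thesis
  proof (rule rev_finite_subset, intro subsetI vimageI2 IntI rangeI)
    show "?h z \<in> cball 0 r" if "z \<in> {z. norm (?h z) \<le> r}" for z
      using that by simp
  qed
qed

section \<open>Multiples of lattice points are not visible\<close>

text \<open>
  The content is a maximum, so a divisor \<open>p > 1\<close> excludes content \<open>1\<close> only once the set of
  divisors is known to be finite. It is, because the quotients \<open>x / l\<close> tend to \<open>0\<close>, whereas the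
  nonzero lattice points stay away from \<open>0\<close>.
\<close>

lemma scaled_lattice_point_not_visible:
  fixes \<Gamma> :: "(real ^ 'n) set"
  assumes "is_lattice \<Gamma>" "y \<in> \<Gamma>" "p > 1"
  shows "real p *\<^sub>R y \<notin> visible_points \<Gamma>"
proof
  assume vis: "real p *\<^sub>R y \<in> visible_points \<Gamma>"
  let ?x = "real p *\<^sub>R y"
  let ?L = "{l. l > 0 \<and> ?x \<in> (\<lambda>y. real l *\<^sub>R y) ` \<Gamma>}"
  have x: "?x \<noteq> 0" "Max ?L = 1"
    using vis by (auto simp: visible_points_def cont_def)
  obtain g :: "real ^ 'n \<Rightarrow> real ^ 'n" where g: "linear g" "inj g"
    and \<Gamma>: "\<Gamma> = range (\<lambda>z. g (int_vec z))"
    using lattice_linear_image[OF assms(1)] by blast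
  obtain B where B: "B > 0" "\<And>u. B * norm u \<le> norm (g u)"
    using linear_inj_bounded_below_pos[OF g] by blast
  have "real l \<le> norm ?x / B" if l: "l \<in> ?L" for l
  proof -
    obtain u where u: "u \<in> \<Gamma>" "?x = real l *\<^sub>R u"
      using l by blast
    then obtain z where z: "?x = real l *\<^sub>R g (int_vec z)"
      unfolding \<Gamma> by blast
    have "z \<noteq> 0"
    proof
      assume "z = 0"
      then have "int_vec z = 0"
        by (simp add: vec_eq_iff)
      then show False
        using x(1) z by (simp add: linear_0[OF g(1)])
    qed
    then have "B * 1 \<le> B * norm (int_vec z)"
      using B(1) one_le_norm_int_vec by (intro mult_left_mono) auto
    also have "\<dots> \<le> norm (g (int_vec z))"
      by (rule B(2))
    finally have "real l * B \<le> real l * norm (g (int_vec z))"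
      by (intro mult_left_mono) auto
    also have "\<dots> = norm ?x"
      using z by simp
    finally show ?thesis
      using B(1) by (simp add: field_simps)
  qed
  then have "?L \<subseteq> {..nat \<lfloor>norm ?x / B\<rfloor>}"
    by (auto simp: le_nat_floor)
  then have "finite ?L"
    by (rule finite_subset) simp
  moreover have "p \<in> ?L"
    using assms by auto
  ultimately have "p \<le> Max ?L"
    by (rule Max_ge)
  then show False
    using x(2) assms(3) by simp
qed

section \<open>Placing divisible points by the Chinese remainder theorem\<close>

lemma distinct_primes_for_finite_set:
  assumes "finite A"
  obtains p :: "'a \<Rightarrow> nat" where "inj_on p A" "\<And>a. a \<in> A \<Longrightarrow> prime (p a)"
proof -
  obtain T where T: "T \<subseteq> {q::nat. prime q}" "finite T" "card T = card A"
    using infinite_arbitrarily_large[OF primes_infinite] by metis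
  obtain p where "bij_betw p A T"
    using finite_same_card_bij[OF assms T(2)] T(3) by metis
  then show thesis
    using that T(1) unfolding bij_betw_def by blast
qed

lemma simultaneous_divisibility:
  fixes u :: "'a \<Rightarrow> int" and m :: "'a \<Rightarrow> nat"
  assumes "finite A" "\<And>a. a \<in> A \<Longrightarrow> m a > 0"
    and "\<And>a b. \<lbrakk>a \<in> A; b \<in> A; a \<noteq> b\<rbrakk> \<Longrightarrow> coprime (m a) (m b)"
  shows "\<exists>x::int. \<forall>a\<in>A. int (m a) dvd x + u a"
proof -
  \<comment> \<open>The residue is reduced modulo \<open>m a\<close> first, so that \<open>nat\<close> does not truncate it.\<close>
  obtain x where x: "\<forall>a\<in>A. [x = nat ((- u a) mod int (m a))] (mod m a)"
    using chinese_remainder_nat[of A m "\<lambda>a. nat ((- u a) mod int (m a))"] assms by blast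
  have "int (m a) dvd int x + u a" if "a \<in> A" for a
  proof -
    have "[int x = int (nat ((- u a) mod int (m a)))] (mod int (m a))"
      using x that by (simp only: cong_int_iff)
    moreover have "int (nat ((- u a) mod int (m a))) = (- u a) mod int (m a)"
      using assms(2)[OF that] by simp
    ultimately have "[int x = - u a] (mod int (m a))"
      by (simp add: cong_def)
    then show ?thesis
      by (simp add: cong_iff_dvd_diff)
  qed
  then show ?thesis
    by blast
qed

text \<open>
  The Chinese remainder theorem is applied in each coordinate separately, with the same primes,
  so that for each \<open>f\<close> a single prime divides all coordinates. Shifting by multiples of the
  product of all the primes keeps the congruences.
\<close>

lemma integer_progression_avoiding_coprimality:
  fixes F :: "(int ^ 'n) set"
  assumes "finite F"
  shows "\<exists>(c :: int ^ 'n) (N :: nat). N > 0 \<and>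
    (\<forall>f\<in>F. \<forall>z. \<exists>p>1. \<forall>i. int p dvd c $ i + int N * z $ i + f $ i)"
proof -
  obtain p :: "int ^ 'n \<Rightarrow> nat" where p: "inj_on p F" "\<And>f. f \<in> F \<Longrightarrow> prime (p f)"
    using distinct_primes_for_finite_set[OF assms] by blast
  have "\<exists>x::int. \<forall>f\<in>F. int (p f) dvd x + f $ i" for i
  proof (rule simultaneous_divisibility[OF assms])
    show "p f > 0" if "f \<in> F" for f
      using p(2)[OF that] by (rule prime_gt_0_nat)
    show "coprime (p f) (p f')" if "f \<in> F" "f' \<in> F" "f \<noteq> f'" for f f'
      using that p by (intro primes_coprime) (auto dest: inj_onD)
  qed
  then obtain c where c: "\<And>i f. f \<in> F \<Longrightarrow> int (p f) dvd c i + f $ i"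
    by metis
  define N where "N = (\<Prod>f\<in>F. p f)"
  have N: "N > 0"
    unfolding N_def using p(2) by (intro prod_pos) (auto simp: prime_gt_0_nat)
  have "\<exists>q>1. \<forall>i. int q dvd (\<chi> i. c i) $ i + int N * z $ i + f $ i" if f: "f \<in> F" for z f
  proof (intro exI[of _ "p f"] conjI allI)
    show "p f > 1"
      using p(2)[OF f] by (rule prime_gt_1_nat)
    have "p f dvd N"
      unfolding N_def using assms f by (rule dvd_prodI)
    then have "int (p f) dvd int N * z $ i" for i
      by (simp add: dvd_mult2)
    then have "int (p f) dvd (c i + f $ i) + int N * z $ i" for i
      using c[OF f] dvd_add by blast
    then show "int (p f) dvd (\<chi> i. c i) $ i + int N * z $ i + f $ i" for i
      by (simp add: algebra_simps)
  qed
  then show ?thesis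
    using N by blast
qed

section \<open>The density of a translated lattice\<close>

definition unit_cell :: "(real ^ 'n) set" where
  "unit_cell = {x. \<forall>i. 0 \<le> x $ i \<and> x $ i < 1}"

lemma unit_cell_subset_cbox: "unit_cell \<subseteq> cbox 0 1"
proof
  fix x :: "real ^ 'n" assume "x \<in> unit_cell"
  then have "0 \<le> x $ i \<and> x $ i \<le> 1" for i
    unfolding unit_cell_def by (auto intro: less_imp_le)
  then show "x \<in> cbox 0 1"
    by (simp add: mem_box_cart)
qed

lemma box_subset_unit_cell: "box 0 1 \<subseteq> unit_cell"
  by (auto simp: unit_cell_def mem_box_cart intro: less_imp_le)

lemma borel_unit_cell: "(unit_cell :: (real ^ 'n) set) \<in> sets borel"
proof -
  have "(unit_cell :: (real ^ 'n) set) = (\<Inter>i. {x. 0 \<le> x $ i} \<inter> {x. x $ i < 1})"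
    by (auto simp: unit_cell_def)
  moreover have "\<dots> \<in> sets borel"
    by (intro sets.finite_INT sets.Int borel_closed borel_open closed_halfspace_component_ge_cart
        open_halfspace_component_lt_cart) auto
  ultimately show ?thesis
    by simp
qed

lemma bounded_linear_image_unit_cell:
  fixes g :: "real ^ 'n \<Rightarrow> real ^ 'n"
  assumes "linear g"
  shows "bounded (g ` unit_cell)"
  using bounded_subset[OF bounded_cbox unit_cell_subset_cbox[where 'a='n]] assms
  by (simp add: bounded_linear_image linear_conv_bounded_linear)

text \<open>The image of the cell under \<open>g\<close> is its preimage under the inverse of \<open>g\<close>, which is
  continuous; hence it is a Borel set.\<close>

lemma lmeasurable_linear_image_unit_cell:
  fixes g :: "real ^ 'n \<Rightarrow> real ^ 'n"
  assumes "linear g" "inj g"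
  shows "g ` unit_cell \<in> lmeasurable"
proof (rule bounded_set_imp_lmeasurable[OF bounded_linear_image_unit_cell[OF assms(1)]])
  obtain h where h: "linear h" "\<And>x. h (g x) = x" "\<And>x. g (h x) = x"
    using linear_injective_isomorphism[OF assms] by blast
  have "h -` unit_cell \<inter> space borel \<in> sets borel"
    using h(1) borel_unit_cell
    by (intro measurable_sets[of h borel borel] borel_measurable_continuous_onI
        linear_continuous_on) (simp_all add: linear_conv_bounded_linear)
  moreover have "g ` unit_cell = h -` unit_cell \<inter> space borel"
    using h(2,3) by (auto intro: rev_image_eqI)
  ultimately show "g ` unit_cell \<in> sets lebesgue"
    by simp
qed

lemma measure_linear_image_unit_cell_pos:
  fixes g :: "real ^ 'n \<Rightarrow> real ^ 'n"
  assumes "linear g" "inj g"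
  shows "0 < measure lebesgue (g ` unit_cell)"
proof -
  have "(\<chi> i. 1 / 2) \<in> (box 0 1 :: (real ^ 'n) set)"
    by (simp add: mem_box_cart)
  moreover have "open (g ` box 0 1)"
    using open_surjective_linear_image[OF open_box assms(1)]
      linear_injective_imp_surjective[OF assms] by blast
  ultimately obtain x e where e: "e > 0" "ball x e \<subseteq> g ` box 0 1"
    by (meson imageI open_contains_ball)
  then have "ball x e \<subseteq> g ` unit_cell"
    using box_subset_unit_cell by blast
  then have "measure lebesgue (ball x e) \<le> measure lebesgue (g ` unit_cell)"
    by (intro measure_mono_fmeasurable lmeasurable_linear_image_unit_cell assms) auto
  moreover have "0 < measure lebesgue (ball x e)"
    using content_ball_pos[OF e(1), of x] by simp
  ultimately show ?thesis
    by linarith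
qed

text \<open>Uniqueness and existence of integer parts: the translates of the cell by integer vectors
  tile the space.\<close>

lemma unit_cell_translates_disjoint:
  assumes "x \<in> unit_cell" "y \<in> unit_cell" "int_vec w + x = int_vec z + y"
  shows "w = z"
proof (simp add: vec_eq_iff, intro allI)
  fix i
  have "real_of_int (w $ i) + x $ i = real_of_int (z $ i) + y $ i"
    using arg_cong[OF assms(3), of "\<lambda>v. v $ i"] by simp
  moreover have "0 \<le> x $ i" "x $ i < 1" "0 \<le> y $ i" "y $ i < 1"
    using assms(1,2) by (auto simp: unit_cell_def)
  ultimately show "w $ i = z $ i"
    by linarith
qed

lemma unit_cell_translates_cover:
  obtains z x where "x \<in> unit_cell" "y = int_vec z + x"
proof
  show "(\<chi> i. frac (y $ i)) \<in> unit_cell"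
    by (simp add: unit_cell_def frac_lt_1)
  show "y = int_vec (\<chi> i. \<lfloor>y $ i\<rfloor>) + (\<chi> i. frac (y $ i))"
    by (simp add: vec_eq_iff frac_def)
qed

lemma measure_ball_scale:
  assumes "r \<ge> 0"
  shows "measure lebesgue (ball (0 :: real ^ 'n) r) = measure lebesgue (ball (0 :: real ^ 'n) 1) * r ^ CARD('n)"
  using content_ball_conv_unit_ball[OF assms, of "0 :: real ^ 'n"] by simp

text \<open>
  The cells attached to the counted points have total volume \<open>v\<close> times their number, where \<open>v\<close>
  is the volume of one cell. A cell attached to a point of norm below \<open>R\<close> lies in
  the ball of radius \<open>R + d\<close>, and each point of the ball of radius \<open>R - d\<close> lies in such a cell.
\<close>

lemma affine_integer_points_count_bounds:
  fixes g :: "real ^ 'n \<Rightarrow> real ^ 'n"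
  assumes g: "linear g" "inj g"
  obtains v d where "v > 0" "d > 0"
    "\<forall>R>d. measure lebesgue (ball (0 :: real ^ 'n) 1) * (R - d) ^ CARD('n)
             \<le> v * real (card {x \<in> range (\<lambda>z. t + g (int_vec z)). norm x < R})"
    "\<forall>R>d. v * real (card {x \<in> range (\<lambda>z. t + g (int_vec z)). norm x < R})
             \<le> measure lebesgue (ball (0 :: real ^ 'n) 1) * (R + d) ^ CARD('n)"
proof -
  define P where "P = g ` unit_cell"
  define v where "v = measure lebesgue P"
  let ?h = "\<lambda>z. t + g (int_vec z)"
  have P: "P \<in> lmeasurable"
    unfolding P_def by (rule lmeasurable_linear_image_unit_cell[OF g])
  have v: "v > 0"
    unfolding v_def P_def by (rule measure_linear_image_unit_cell_pos[OF g])
  have "bounded P"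
    unfolding P_def by (rule bounded_linear_image_unit_cell[OF g(1)])
  then obtain d where d: "d > 0" "\<And>x. x \<in> P \<Longrightarrow> norm x \<le> d"
    using bounded_pos by blast
  have inj_h: "inj ?h"
    by (intro injI) (simp add: inj_eq[OF g(2)])
  have main: "measure lebesgue (ball (0 :: real ^ 'n) 1) * (R - d) ^ CARD('n)
                \<le> v * real (card {x \<in> range ?h. norm x < R}) \<and>
              v * real (card {x \<in> range ?h. norm x < R})
                \<le> measure lebesgue (ball (0 :: real ^ 'n) 1) * (R + d) ^ CARD('n)"
    if "R > d" for R
  proof -
    define Z where "Z = {z. norm (?h z) < R}"
    define U where "U = (\<Union>z\<in>Z. (+) (?h z) ` P)"
    have finZ: "finite Z"
      by (rule finite_subset[OF _ finite_affine_integer_points_bounded[OF g, of t R]])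
         (auto simp: Z_def)
    have "{x \<in> range ?h. norm x < R} = ?h ` Z"
      by (auto simp: Z_def)
    then have cardZ: "card {x \<in> range ?h. norm x < R} = card Z"
      using card_image[OF inj_on_subset[OF inj_h subset_UNIV], of Z] by simp
    have disj: "w = z" if "y \<in> (+) (?h w) ` P" "y \<in> (+) (?h z) ` P" for w z y
    proof -
      obtain a b where ab: "a \<in> unit_cell" "b \<in> unit_cell" "?h w + g a = ?h z + g b"
        using \<open>y \<in> (+) (?h w) ` P\<close> \<open>y \<in> (+) (?h z) ` P\<close> unfolding P_def by auto
      then have "g (int_vec w + a) = g (int_vec z + b)"
        by (simp add: linear_add[OF g(1)] algebra_simps)
      then have "int_vec w + a = int_vec z + b"
        using g(2) by (simp add: inj_eq)
      then show ?thesis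
        using unit_cell_translates_disjoint ab by blast
    qed
    have U: "U \<in> lmeasurable"
      unfolding U_def using finZ by (intro fmeasurable.finite_UN measurable_translation P) auto
    have "measure lebesgue U = (\<Sum>z\<in>Z. measure lebesgue ((+) (?h z) ` P))"
      unfolding U_def
    proof (rule measure_UNION'[OF finZ])
      show "pairwise (\<lambda>w z. disjnt ((+) (?h w) ` P) ((+) (?h z) ` P)) Z"
        unfolding pairwise_def disjnt_def using disj by blast
    qed (rule measurable_translation[OF P])
    also have "\<dots> = v * real (card Z)"
      by (simp add: measure_translation v_def)
    finally have mU: "measure lebesgue U = v * real (card Z)" .
    have "U \<subseteq> ball 0 (R + d)"
    proof
      fix y assume "y \<in> U"
      then obtain z q where zq: "z \<in> Z" "q \<in> P" "y = ?h z + q"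
        unfolding U_def by auto
      have "norm y \<le> norm (?h z) + norm q"
        unfolding zq(3) by (rule norm_triangle_ineq)
      also have "\<dots> < R + d"
        using zq d(2)[OF zq(2)] by (simp add: Z_def)
      finally show "y \<in> ball 0 (R + d)"
        by simp
    qed
    then have "measure lebesgue U \<le> measure lebesgue (ball (0 :: real ^ 'n) (R + d))"
      using U by (intro measure_mono_fmeasurable) auto
    then have upper: "v * real (card Z)
        \<le> measure lebesgue (ball (0 :: real ^ 'n) 1) * (R + d) ^ CARD('n)"
      using mU measure_ball_scale[of "R + d", where 'n='n] that d(1) by simp
    have "ball 0 (R - d) \<subseteq> U"
    proof
      fix y :: "real ^ 'n" assume y: "y \<in> ball 0 (R - d)"
      obtain u where u: "y - t = g u"
        using linear_injective_imp_surjective[OF g] by (metis surjD)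
      obtain z x where x: "x \<in> unit_cell" "u = int_vec z + x"
        by (rule unit_cell_translates_cover)
      have y_eq: "y = ?h z + g x"
        using u x(2) by (simp add: linear_add[OF g(1)] algebra_simps)
      have gx: "g x \<in> P"
        unfolding P_def using x(1) by blast
      have "norm (?h z) = norm (y - g x)"
        using y_eq by simp
      also have "\<dots> \<le> norm y + norm (g x)"
        by (rule norm_triangle_ineq4)
      also have "\<dots> < R"
        using y d(2)[OF gx] by simp
      finally show "y \<in> U"
        unfolding U_def Z_def using y_eq gx by blast
    qed
    then have "measure lebesgue (ball (0 :: real ^ 'n) (R - d)) \<le> measure lebesgue U"
      using U by (intro measure_mono_fmeasurable) auto
    then have "measure lebesgue (ball (0 :: real ^ 'n) 1) * (R - d) ^ CARD('n)
        \<le> v * real (card Z)"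
      using mU measure_ball_scale[of "R - d", where 'n='n] that by simp
    with upper cardZ show ?thesis
      by simp
  qed
  show thesis
    using main by (intro that[OF v d(1)]) auto
qed

lemma natural_density_affine_integer_points:
  fixes g :: "real ^ 'n \<Rightarrow> real ^ 'n"
  assumes "linear g" "inj g"
  shows "\<exists>D>0. has_natural_density (range (\<lambda>z. t + g (int_vec z))) D"
proof -
  define w where "w = measure lebesgue (ball (0 :: real ^ 'n) 1)"
  define K where "K R = real (card {x \<in> range (\<lambda>z. t + g (int_vec z)). norm x < R})" for R
  obtain v d where v: "v > 0" and d: "d > 0"
    and lower: "\<forall>R>d. w * (R - d) ^ CARD('n) \<le> v * K R"
    and upper: "\<forall>R>d. v * K R \<le> w * (R + d) ^ CARD('n)"
    by (rule affine_integer_points_count_bounds[OF assms, of t, folded w_def K_def])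
  have w: "w > 0"
    unfolding w_def using content_ball_pos[of 1 "0 :: real ^ 'n"] by simp
  have lim: "((\<lambda>R. (1 + e / R) ^ CARD('n) / v) \<longlongrightarrow> 1 / v) at_top" for e :: real
  proof -
    have "((\<lambda>R. e / R) \<longlongrightarrow> 0) at_top"
      by (intro tendsto_divide_0[OF tendsto_const] filterlim_at_top_imp_at_infinity filterlim_ident)
    then have "((\<lambda>R. (1 + e / R) ^ CARD('n) / v) \<longlongrightarrow> (1 + 0) ^ CARD('n) / v) at_top"
      using v by (intro tendsto_intros) auto
    then show ?thesis
      by simp
  qed
  have ratio: "w * (R + e) ^ CARD('n) / (v * (w * R ^ CARD('n))) = (1 + e / R) ^ CARD('n) / v"
    if "R > d" for R e
  proof -
    have "(1 + e / R) ^ CARD('n) = (R + e) ^ CARD('n) / R ^ CARD('n)"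
      using that d by (simp add: power_divide[symmetric] add_divide_distrib)
    then show ?thesis
      using w v by simp
  qed
  have "((\<lambda>R. K R / (w * R ^ CARD('n))) \<longlongrightarrow> 1 / v) at_top"
  proof (rule tendsto_sandwich[OF _ _ lim[of "- d"] lim[of d]])
    have K_eq: "K R / (w * R ^ CARD('n)) = v * K R / (v * (w * R ^ CARD('n)))" for R
      using v by simp
    have pos: "0 \<le> v * (w * R ^ CARD('n))" if "R > d" for R
      using that v w d by simp
    show "\<forall>\<^sub>F R in at_top. (1 + - d / R) ^ CARD('n) / v \<le> K R / (w * R ^ CARD('n))"
      using eventually_gt_at_top[of d]
    proof eventually_elim
      case (elim R)
      show ?case
        unfolding K_eq ratio[OF elim, of "- d", symmetric]
        using lower elim pos[OF elim] by (intro divide_right_mono) auto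
    qed
    show "\<forall>\<^sub>F R in at_top. K R / (w * R ^ CARD('n)) \<le> (1 + d / R) ^ CARD('n) / v"
      using eventually_gt_at_top[of d]
    proof eventually_elim
      case (elim R)
      show ?case
        unfolding K_eq ratio[OF elim, of d, symmetric]
        using upper elim pos[OF elim] by (intro divide_right_mono) auto
    qed
  qed
  then have "has_natural_density (range (\<lambda>z. t + g (int_vec z))) (1 / v)"
    unfolding has_natural_density_def w_def K_def .
  then show ?thesis
    using v by (intro exI[of _ "1 / v"]) simp
qed

section \<open>Holes in the set of visible points\<close>

text \<open>
  A lattice point \<open>y\<close> in the closed ball around the centre \<open>a\<close> has a difference \<open>y - a\<close> among the
  finitely many short lattice vectors \<open>F\<close>, and the congruences imposed on \<open>a\<close> for this difference
  make \<open>y\<close> divisible by a number greater than \<open>1\<close>.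
\<close>

lemma periodic_hole_centres:
  fixes \<Gamma> :: "(real ^ 'n) set"
  assumes \<Gamma>: "is_lattice \<Gamma>"
  obtains t and g :: "real ^ 'n \<Rightarrow> real ^ 'n"
  where "linear g" "inj g" "\<forall>z. hole_centre (visible_points \<Gamma>) r (t + g (int_vec z))"
proof -
  obtain g :: "real ^ 'n \<Rightarrow> real ^ 'n" where g: "linear g" "inj g"
    and \<Gamma>_eq: "\<Gamma> = range (\<lambda>z. g (int_vec z))"
    using lattice_linear_image[OF \<Gamma>] by blast
  define F where "F = {f. norm (g (int_vec f)) \<le> r}"
  have F: "finite F"
    using finite_affine_integer_points_bounded[OF g, of 0 r] by (simp add: F_def)
  obtain c :: "int ^ 'n" and N :: nat where N: "N > 0"
    and dvd: "\<forall>f\<in>F. \<forall>z. \<exists>p>1. \<forall>i. int p dvd c $ i + int N * z $ i + f $ i"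
    using integer_progression_avoiding_coprimality[OF F] by (elim exE conjE) (rule that)
  define h where "h x = real N *\<^sub>R g x" for x
  have "linear h"
    unfolding h_def by (rule linear_compose_scale_right[OF g(1)])
  have "inj h"
    using g(2) N by (simp add: h_def inj_on_def)
  have "hole_centre (visible_points \<Gamma>) r (g (int_vec c) + h (int_vec z))" for z
    unfolding hole_centre_def
  proof (rule ccontr)
    define a where "a = (\<chi> i. c $ i + int N * z $ i)"
    have "int_vec a = int_vec c + real N *\<^sub>R int_vec z"
      by (simp add: vec_eq_iff a_def)
    then have centre: "g (int_vec c) + h (int_vec z) = g (int_vec a)"
      by (simp add: h_def linear_add[OF g(1)] linear_scale[OF g(1)])
    assume "cball (g (int_vec c) + h (int_vec z)) r \<inter> visible_points \<Gamma> \<noteq> {}"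
    then obtain x where x: "x \<in> visible_points \<Gamma>" "norm (g (int_vec a) - x) \<le> r"
      unfolding centre by (auto simp: dist_norm)
    then obtain y where y: "x = g (int_vec y)"
      unfolding \<Gamma>_eq visible_points_def by blast
    have "y - a \<in> F"
      using x(2) by (simp add: F_def y int_vec_diff linear_diff[OF g(1)] norm_minus_commute)
    then have "\<exists>p>1. \<forall>i. int p dvd c $ i + int N * z $ i + (y - a) $ i"
      using dvd by blast
    then obtain p where p: "p > 1" "\<forall>i. int p dvd y $ i"
      by (auto simp: a_def)
    define u where "u = (\<chi> i. y $ i div int p)"
    have "y $ i = int p * u $ i" for i
      using p(2) by (simp add: u_def)
    then have "int_vec y = real p *\<^sub>R int_vec u"
      by (simp add: vec_eq_iff)
    then have "x = real p *\<^sub>R g (int_vec u)"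
      by (simp add: y linear_scale[OF g(1)])
    moreover have "g (int_vec u) \<in> \<Gamma>"
      unfolding \<Gamma>_eq by blast
    ultimately show False
      using scaled_lattice_point_not_visible[OF \<Gamma> _ p(1)] x(1) by blast
  qed
  then have "\<forall>z. hole_centre (visible_points \<Gamma>) r (g (int_vec c) + h (int_vec z))"
    by (intro allI)
  with \<open>linear h\<close> \<open>inj h\<close> show thesis
    by (rule that)
qed

theorem proposition4:
  fixes \<Gamma> :: "(real ^ 'n) set"
  assumes "is_lattice \<Gamma>"
  shows "uniform_discrete (visible_points \<Gamma>) \<and>
         (\<forall>r>0. \<exists>c. hole_centre (visible_points \<Gamma>) r c) \<and>
         (\<forall>r>0. \<exists>C D. uniform_discrete C \<and>
            (\<forall>c\<in>C. hole_centre (visible_points \<Gamma>) r c) \<and>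
            has_natural_density C D \<and> D > 0)"
proof (intro conjI allI impI)
  obtain g :: "real ^ 'n \<Rightarrow> real ^ 'n" where g: "linear g" "inj g"
    and \<Gamma>: "\<Gamma> = range (\<lambda>z. g (int_vec z))"
    using lattice_linear_image[OF assms] by blast
  have "uniform_discrete \<Gamma>"
    using uniform_discrete_affine_integer_points[OF g, of 0] by (simp add: \<Gamma>)
  then show "uniform_discrete (visible_points \<Gamma>)"
    by (rule uniform_discrete_subset) (auto simp: visible_points_def)
next
  fix r :: real
  show "\<exists>c. hole_centre (visible_points \<Gamma>) r c"
    using periodic_hole_centres[OF assms, of r] by blast
  obtain t and g :: "real ^ 'n \<Rightarrow> real ^ 'n" where g: "linear g" "inj g"
    and hole: "\<forall>z. hole_centre (visible_points \<Gamma>) r (t + g (int_vec z))"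
    using periodic_hole_centres[OF assms, of r] by blast
  obtain D where "D > 0" "has_natural_density (range (\<lambda>z. t + g (int_vec z))) D"
    using natural_density_affine_integer_points[OF g] by blast
  then show "\<exists>C D. uniform_discrete C \<and> (\<forall>c\<in>C. hole_centre (visible_points \<Gamma>) r c) \<and>
      has_natural_density C D \<and> D > 0"
    using uniform_discrete_affine_integer_points[OF g, of t] hole by blast
qed

end
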